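(* Let $n\ge 1$ be an integer, let $v$ be a cell of the $n\times n$ board, and let $x$ be the number of cells attacked by a queen on $v$. Then any set of queens that traps an enemy queen on $v$ contains at least $\frac{x}{12}$ queens. Moreover $3n-3\le x\le 4n-4$, so in particular any such set contains at least $\left\lceil\frac{n-1}{4}\right\rceil$ queens.
   Context: Cells of the $n\times n$ board are $(i,j)$ with $1\le i,j\le n$. A queen attacks (can move to) every other cell in the same row, in the same column, or on a line of slope $1$ or $-1$ through its cell (other pieces do not block). A set $T$ of cells not containing $v$ (the positions of the soldier queens) traps an enemy queen on $v$ if: (1) no two distinct cells of $T\cup\{v\}$ attack each other; and (2) every cell attacked from $v$ is attacked from some cell of $T$. *)

theory Defs
  imports Complex_Main
begin

type_synonym cell = "int \<times> int"

definition board :: "nat \<Rightarrow> cell set" where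
  "board n = {1..int n} \<times> {1..int n}"

text \<open>The four disjuncts are: same row, same column, same line of slope 1, same line of
  slope -1. Other pieces do not block, so the relation depends on the two cells only.\<close>

definition attacks :: "cell \<Rightarrow> cell \<Rightarrow> bool" where
  "attacks u w \<longleftrightarrow> u \<noteq> w \<and>
     (fst u = fst w \<or> snd u = snd w \<or>
      snd w - snd u = fst w - fst u \<or> snd w - snd u = - (fst w - fst u))"

definition attacked_cells :: "nat \<Rightarrow> cell \<Rightarrow> cell set" where
  "attacked_cells n u = {w \<in> board n. attacks u w}"

definition traps :: "nat \<Rightarrow> cell set \<Rightarrow> cell \<Rightarrow> bool" where
  "traps n T v \<longleftrightarrow> T \<subseteq> board n \<and> v \<notin> T \<and>
     (\<forall>a \<in> T \<union> {v}. \<forall>b \<in> T \<union> {v}. a \<noteq> b \<longrightarrow> \<not> attacks a b) \<and>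
     (\<forall>w \<in> attacked_cells n v. \<exists>t \<in> T. w \<in> attacked_cells n t)"

end

theory Submission
  imports Defs
begin

text \<open>A queen move follows one of four directions, so four lines run through the cell \<open>v\<close> of the
  enemy queen and four through the cell \<open>t\<close> of a soldier. If \<open>t\<close> does not attack \<open>v\<close>, then no
  line is common to both cells. Hence two parallel lines of the two families do not
  meet, and each of the twelve remaining pairs meets in at most one cell. One
  soldier therefore guards at most 12 of the \<open>x\<close> cells attacked from \<open>v\<close>
  (\<open>card_common_attacked_le\<close>), and since the soldiers together have to guard all of them,
  there are at least \<open>x / 12\<close> soldiers.

  For the bounds on \<open>x\<close> (\<open>card_attacked_cells_bounds\<close>), the row and the column contribute
  \<open>n - 1\<close> cells each. The diagonals through \<open>(a, b)\<close> contribute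
  \<open>n - 1 - \<bar>a - b\<bar>\<close> and \<open>n - 1 - \<bar>a + b - (n + 1)\<bar>\<close> cells, and
  \<open>\<bar>a - b\<bar> + \<bar>a + b - (n + 1)\<bar>\<close> is the larger of \<open>\<bar>2 * a - (n + 1)\<bar>\<close> and
  \<open>\<bar>2 * b - (n + 1)\<bar>\<close>, which lies between \<open>0\<close> and \<open>n - 1\<close>.\<close>

section \<open>Cells attacked from two non-attacking cells\<close>

lemma finite_board: "finite (board n)"
  by (simp add: board_def)

text \<open>The list in the proof holds the intersections of non-parallel lines, three on each line
  through \<open>v\<close>. Two perpendicular diagonals may cross between cells; rounding by \<open>div\<close> then lists
  a superfluous cell, which does no harm to an upper bound.\<close>

lemma card_common_attacked_le:
  assumes "t \<noteq> v" "\<not> attacks t v"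
  shows "card (attacked_cells n v \<inter> attacked_cells n t) \<le> 12"
proof -
  obtain a b p q where v: "v = (a, b)" and t: "t = (p, q)"
    by (cases v, cases t) blast
  define L where "L =
    [(a, q), (a, q + (a - p)), (a, q - (a - p)),
     (p, b), (p + (b - q), b), (p - (b - q), b)] @
    map (\<lambda>c. (c, b + (c - a))) [p, a + (q - b), (p + q + a - b) div 2] @
    map (\<lambda>c. (c, b - (c - a))) [p, a - (q - b), (a + b + p - q) div 2]"
  have "attacked_cells n v \<inter> attacked_cells n t \<subseteq> set L"
  proof
    fix w assume w: "w \<in> attacked_cells n v \<inter> attacked_cells n t"
    obtain c d where cd: "w = (c, d)" by (cases w)
    have no_common_line: "a \<noteq> p" "b \<noteq> q" "b - q \<noteq> a - p" "b - q \<noteq> - (a - p)"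
      using assms by (auto simp: attacks_def v t)
    have on_v: "c = a \<or> d = b \<or> d - b = c - a \<or> d - b = - (c - a)"
      and on_t: "c = p \<or> d = q \<or> d - q = c - p \<or> d - q = - (c - p)"
      using w by (auto simp: attacked_cells_def attacks_def v t cd)
    from on_v consider "c = a" | "d = b" | "d - b = c - a" | "d - b = - (c - a)"
      by blast
    then show "w \<in> set L"
    proof cases
      case 1
      then have "d = q \<or> d = q + (a - p) \<or> d = q - (a - p)"
        using on_t no_common_line(1) 1 by auto
      with 1 show ?thesis by (auto simp: L_def cd)
    next
      case 2
      then have "c = p \<or> c = p + (b - q) \<or> c = p - (b - q)"
        using on_t no_common_line(2) 2 by auto
      with 2 show ?thesis by (auto simp: L_def cd)
    next
      case 3
      then have "c = p \<or> c = a + (q - b) \<or> 2 * c = p + q + a - b"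
        using on_t no_common_line(3) 3 by auto
      then have "c \<in> set [p, a + (q - b), (p + q + a - b) div 2]"
        by auto
      moreover have "w = (c, b + (c - a))" using 3 cd by simp
      ultimately show ?thesis unfolding L_def set_append set_map by blast
    next
      case 4
      then have "c = p \<or> c = a - (q - b) \<or> 2 * c = a + b + p - q"
        using on_t no_common_line(4) 4 by auto
      then have "c \<in> set [p, a - (q - b), (a + b + p - q) div 2]"
        by auto
      moreover have "w = (c, b - (c - a))" using 4 cd by simp
      ultimately show ?thesis unfolding L_def set_append set_map by blast
    qed
  qed
  then have "card (attacked_cells n v \<inter> attacked_cells n t) \<le> card (set L)"
    by (simp add: card_mono)
  also have "\<dots> \<le> length L" by (rule card_length)
  also have "\<dots> = 12" by (simp add: L_def)
  finally show ?thesis .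
qed

lemma card_attacked_cells_le_traps:
  assumes "traps n T v"
  shows "card (attacked_cells n v) \<le> 12 * card T"
proof -
  have finT: "finite T"
    using assms finite_subset[OF _ finite_board] by (auto simp: traps_def)
  have "attacked_cells n v = (\<Union>t\<in>T. attacked_cells n v \<inter> attacked_cells n t)"
    using assms by (auto simp: traps_def)
  then have "card (attacked_cells n v)
      \<le> (\<Sum>t\<in>T. card (attacked_cells n v \<inter> attacked_cells n t))"
    using card_UN_le[OF finT, of "\<lambda>t. attacked_cells n v \<inter> attacked_cells n t"] by simp
  also have "\<dots> \<le> (\<Sum>t\<in>T. 12)"
  proof (rule sum_mono)
    fix t assume "t \<in> T"
    with assms have "t \<noteq> v" "\<not> attacks t v"
      by (auto simp: traps_def)
    then show "card (attacked_cells n v \<inter> attacked_cells n t) \<le> 12"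
      by (rule card_common_attacked_le)
  qed
  finally show ?thesis by simp
qed

section \<open>Counting the cells attacked by one queen\<close>

text \<open>Removing \<open>v\<close> makes the four lines disjoint, and a diagonal is counted through the interval
  of step lengths \<open>k\<close> that stay on the board.\<close>

lemma card_attacked_cells:
  assumes "(a, b) \<in> board n"
  shows "int (card (attacked_cells n (a, b))) =
    4 * (int n - 1) - (\<bar>a - b\<bar> + \<bar>a + b - (int n + 1)\<bar>)"
proof -
  define N where "N = int n"
  have ab: "1 \<le> a" "a \<le> N" "1 \<le> b" "b \<le> N"
    using assms by (auto simp: board_def N_def)
  define C where "C = {a} \<times> ({1..N} - {b})"
  define R where "R = ({1..N} - {a}) \<times> {b}"
  define I where "I = {max (1 - a) (1 - b)..min (N - a) (N - b)}"
  define J where "J = {max (1 - a) (b - N)..min (N - a) (b - 1)}"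
  define D where "D = (\<lambda>k. (a + k, b + k)) ` (I - {0})"
  define E where "E = (\<lambda>k. (a + k, b - k)) ` (J - {0})"
  have zero_in: "0 \<in> I" "0 \<in> J"
    using ab by (auto simp: I_def J_def)
  have fin: "finite C" "finite R" "finite D" "finite E"
    by (simp_all add: C_def R_def D_def E_def I_def J_def)
  have "attacked_cells n (a, b) = C \<union> R \<union> D \<union> E"
  proof (intro equalityI subsetI)
    fix w assume w: "w \<in> attacked_cells n (a, b)"
    obtain c d where cd: "w = (c, d)" by (cases w)
    have bnd: "1 \<le> c" "c \<le> N" "1 \<le> d" "d \<le> N" and ne: "(c, d) \<noteq> (a, b)"
      and lines: "c = a \<or> d = b \<or> d - b = c - a \<or> d - b = - (c - a)"
      using w by (auto simp: attacked_cells_def attacks_def board_def N_def cd)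
    from lines consider "c = a" | "d = b" | "d - b = c - a" | "d - b = - (c - a)"
      by blast
    then show "w \<in> C \<union> R \<union> D \<union> E"
    proof cases
      case 1
      then show ?thesis using bnd ne by (auto simp: C_def cd)
    next
      case 2
      then show ?thesis using bnd ne by (auto simp: R_def cd)
    next
      case 3
      then have "w = (a + (c - a), b + (c - a))" "c - a \<in> I - {0}"
        using bnd ne by (auto simp: I_def cd)
      then show ?thesis unfolding D_def by blast
    next
      case 4
      then have "w = (a + (c - a), b - (c - a))" "c - a \<in> J - {0}"
        using bnd ne by (auto simp: J_def cd)
      then show ?thesis unfolding E_def by blast
    qed
  next
    fix w assume "w \<in> C \<union> R \<union> D \<union> E"
    then show "w \<in> attacked_cells n (a, b)"
      using ab by (auto simp: C_def R_def D_def E_def I_def J_def N_def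
          attacked_cells_def attacks_def board_def)
  qed
  moreover have "C \<inter> R = {}" "(C \<union> R) \<inter> D = {}" "(C \<union> R \<union> D) \<inter> E = {}"
    by (auto simp: C_def R_def D_def E_def)
  ultimately have "card (attacked_cells n (a, b)) = card C + card R + card D + card E"
    using fin by (simp add: card_Un_disjoint)
  moreover have "int (card C) = N - 1" "int (card R) = N - 1"
    using ab by (simp_all add: C_def R_def card_cartesian_product)
  moreover have "int (card D) = N - 1 - \<bar>a - b\<bar>"
  proof -
    have "card D = card (I - {0})"
      unfolding D_def by (rule card_image) (simp add: inj_on_def)
    then show ?thesis
      using zero_in ab by (simp add: I_def)
  qed
  moreover have "int (card E) = N - 1 - \<bar>a + b - (N + 1)\<bar>"
  proof -
    have "card E = card (J - {0})"
      unfolding E_def by (rule card_image) (simp add: inj_on_def)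
    then show ?thesis
      using zero_in ab by (simp add: J_def)
  qed
  ultimately show ?thesis by (simp add: N_def)
qed

lemma card_attacked_cells_bounds:
  assumes "v \<in> board n"
  shows "3 * int n - 3 \<le> int (card (attacked_cells n v))"
    and "int (card (attacked_cells n v)) \<le> 4 * int n - 4"
proof -
  obtain a b where v: "v = (a, b)" by (cases v)
  have "1 \<le> a" "a \<le> int n" "1 \<le> b" "b \<le> int n"
    using assms by (auto simp: board_def v)
  then have "\<bar>a - b\<bar> + \<bar>a + b - (int n + 1)\<bar> \<le> int n - 1"
    by linarith
  then show "3 * int n - 3 \<le> int (card (attacked_cells n v))"
    and "int (card (attacked_cells n v)) \<le> 4 * int n - 4"
    using card_attacked_cells[of a b n] assms by (simp_all add: v)
qed

section \<open>The lower bound on the number of soldiers\<close>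

theorem mainTheorem11:
  fixes n x :: nat and v :: cell
  assumes "n \<ge> 1"
    and "v \<in> board n"
    and "x = card (attacked_cells n v)"
  shows "(\<forall>T. traps n T v \<longrightarrow> real (card T) \<ge> real x / 12) \<and>
         3 * int n - 3 \<le> int x \<and> int x \<le> 4 * int n - 4 \<and>
         (\<forall>T. traps n T v \<longrightarrow> int (card T) \<ge> \<lceil>(real n - 1) / 4\<rceil>)"
proof -
  have lower: "3 * int n - 3 \<le> int x" and upper: "int x \<le> 4 * int n - 4"
    using card_attacked_cells_bounds[OF assms(2)] assms(3) by simp_all
  have x_le: "x \<le> 12 * card T" if "traps n T v" for T
    using card_attacked_cells_le_traps[OF that] assms(3) by simp
  have "real x / 12 \<le> real (card T)" if "traps n T v" for T
    using x_le[OF that] by linarith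
  moreover have "\<lceil>(real n - 1) / 4\<rceil> \<le> int (card T)" if "traps n T v" for T
  proof -
    have "int n - 1 \<le> 4 * int (card T)"
      using lower x_le[OF that] by linarith
    then have "real_of_int (int n - 1) \<le> real_of_int (4 * int (card T))"
      by (simp only: of_int_le_iff)
    then have "(real n - 1) / 4 \<le> real_of_int (int (card T))"
      by simp
    then show ?thesis by (simp only: ceiling_le_iff)
  qed
  ultimately show ?thesis
    using lower upper by blast
qed

end
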